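(* Let $\{F_\theta:\theta\in\Theta\}$ be a standard exponential family generated by $F_0$, with $\Theta=[0,\theta_{\max})$, and for $\theta\in\Theta$ let $X_1,X_2,\dots$ be i.i.d. with law $F_\theta$ under $\mathbb{P}_\theta$. Let $C>0$, $r>0$, $\theta^\ast>0$ with $[0,\theta^\ast]\subset\Theta$ be constants such that for all $b>0$ and $y>0$ $$\sup_{\theta\in[0,\theta^\ast]}\bigl|\mathbb{P}_\theta(R_b\le y)-\mathbb{P}_\theta(R_\infty\le y)\bigr|\le C e^{-r(b+y)} .$$ Then for every Lipschitz function $g:[0,\infty)\to\mathbb{R}$ with Lipschitz constant $\mathrm{Lip}(g)$ and all $b>0$, $$\sup_{\theta\in[0,\theta^\ast]}\bigl|\mathbb{E}_\theta g(R_b)-\mathbb{E}_\theta g(R_\infty)\bigr|\le \mathrm{Lip}(g)\sup_{\theta\in[0,\theta^\ast]}W_1(R_b,R_\infty)\le \mathrm{Lip}(g)\,\frac{C}{r}\,e^{-rb}.$$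
   Context: Standard exponential family: $F_0$ is a probability measure on $\mathbb{R}$ and $\Theta=[0,\theta_{\max})$, $\theta_{\max}\in(0,\infty]$, is such that $\int e^{\theta x}F_0(dx)<\infty$ for all $\theta\in\Theta$. Put $\psi(\theta)=\ln\int e^{\theta x}F_0(dx)$ and $F_\theta(dx)=e^{\theta x-\psi(\theta)}F_0(dx)$. The family $\{F_\theta\}$ is called standard if, for $X\sim F_0$, $\mathbb{E}[X]=0$ and $\mathrm{Var}(X)=1$, and $F_0$ is strongly non-lattice, i.e. $\limsup_{|t|\to\infty}\left|\int e^{itx}F_0(dx)\right|<1$. $\mathbb{P}_\theta,\mathbb{E}_\theta$ denote probability and expectation when $X_1,X_2,\dots$ are i.i.d. with law $F_\theta$. $S_0=0$, $S_n=X_1+\dots+X_n$. For $b\ge 0$: $\tau(b)=\inf\{n\ge1:S_n>b\}$ and the overshoot is $R_b=S_{\tau(b)}-b$. $R_\infty$ denotes a nonnegative random variable whose law under $\mathbb{P}_\theta$ is the weak limit of the law of $R_b$ under $\mathbb{P}_\theta$ as $b\to\infty$ (this limit is known to exist). It is a known result from the literature that constants $C,r,\theta^\ast$ with the assumed uniform estimate exist for every standard exponential family. For real random variables $X,Y$ with finite first moments, $W_1(X,Y)=\inf\{\mathbb{E}|X'-Y'|: X'\stackrel{d}{=}X,\ Y'\stackrel{d}{=}Y\}$, the infimum over all joint constructions (couplings) $(X',Y')$. For each $\theta$, $W_1(R_b,R_\infty)$ is taken for the laws under $\mathbb{P}_\theta$. *)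

theory Defs
  imports "HOL-Probability.Probability" "HOL-Library.Extended_Nat"
begin

definition param_set :: "ereal \<Rightarrow> real set" where
  "param_set \<theta>max = {\<theta>. 0 \<le> \<theta> \<and> ereal \<theta> < \<theta>max}"

definition log_mgf :: "real measure \<Rightarrow> real \<Rightarrow> real" where
  "log_mgf F0 \<theta> = ln (\<integral>x. exp (\<theta> * x) \<partial>F0)"

definition tilted :: "real measure \<Rightarrow> real \<Rightarrow> real measure" where
  "tilted F0 \<theta> = density F0 (\<lambda>x. ennreal (exp (\<theta> * x - log_mgf F0 \<theta>)))"

(* On the real line the filter at_infinity is |t| --> infinity. *)
definition strongly_nonlattice :: "real measure \<Rightarrow> bool" where
  "strongly_nonlattice F0 \<longleftrightarrow> Limsup at_infinity (\<lambda>t. ereal (cmod (char F0 t))) < 1"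

definition standard_exp_family :: "real measure \<Rightarrow> ereal \<Rightarrow> bool" where
  "standard_exp_family F0 \<theta>max \<longleftrightarrow>
     real_distribution F0 \<and> 0 < \<theta>max \<and>
     (\<forall>\<theta>\<in>param_set \<theta>max. integrable F0 (\<lambda>x. exp (\<theta> * x))) \<and>
     integrable F0 (\<lambda>x. x) \<and> prob_space.expectation F0 (\<lambda>x. x) = 0 \<and>
     integrable F0 (\<lambda>x. x\<^sup>2) \<and> prob_space.variance F0 (\<lambda>x. x) = 1 \<and>
     strongly_nonlattice F0"

(* The sequence is X 1, X 2, ...; the value X 0 is never used. *)
definition iid_with_law :: "'w measure \<Rightarrow> (nat \<Rightarrow> 'w \<Rightarrow> real) \<Rightarrow> real measure \<Rightarrow> bool" where
  "iid_with_law M X F \<longleftrightarrow>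
     prob_space M \<and> prob_space.indep_vars M (\<lambda>_. borel) X {1..} \<and>
     (\<forall>n\<ge>1. distr M borel (X n) = F)"

definition partial_sum :: "(nat \<Rightarrow> 'w \<Rightarrow> real) \<Rightarrow> nat \<Rightarrow> 'w \<Rightarrow> real" where
  "partial_sum X n \<omega> = (\<Sum>i=1..n. X i \<omega>)"

definition passage_time :: "(nat \<Rightarrow> 'w \<Rightarrow> real) \<Rightarrow> real \<Rightarrow> 'w \<Rightarrow> enat" where
  "passage_time X b \<omega> = (INF n \<in> {n. 1 \<le> n \<and> b < partial_sum X n \<omega>}. enat n)"

(* For nonnegative drift the passage time is almost surely finite; the value 0 on the
   exceptional null set only makes the overshoot total and nonnegative. *)
definition overshoot :: "(nat \<Rightarrow> 'w \<Rightarrow> real) \<Rightarrow> real \<Rightarrow> 'w \<Rightarrow> real" where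
  "overshoot X b \<omega> =
     (case passage_time X b \<omega> of enat n \<Rightarrow> partial_sum X n \<omega> - b | \<infinity> \<Rightarrow> 0)"

abbreviation overshoot_law :: "'w measure \<Rightarrow> (nat \<Rightarrow> 'w \<Rightarrow> real) \<Rightarrow> real \<Rightarrow> real measure" where
  "overshoot_law M X b \<equiv> distr M borel (overshoot X b)"

(* weak_conv_m is for sequences of laws, hence b --> infinity along arbitrary sequences. *)
definition is_limit_overshoot_law ::
    "'w measure \<Rightarrow> (nat \<Rightarrow> 'w \<Rightarrow> real) \<Rightarrow> real measure \<Rightarrow> bool" where
  "is_limit_overshoot_law M X \<rho> \<longleftrightarrow>
     real_distribution \<rho> \<and> (AE x in \<rho>. 0 \<le> x) \<and>
     (\<forall>\<beta> :: nat \<Rightarrow> real. filterlim \<beta> at_top sequentially \<longrightarrow>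
        weak_conv_m (\<lambda>n. overshoot_law M X (\<beta> n)) \<rho>)"

definition couplings :: "real measure \<Rightarrow> real measure \<Rightarrow> (real \<times> real) measure set" where
  "couplings \<mu> \<nu> =
     {\<pi>. prob_space \<pi> \<and> sets \<pi> = sets (borel \<Otimes>\<^sub>M borel) \<and>
         distr \<pi> borel fst = \<mu> \<and> distr \<pi> borel snd = \<nu>}"

(* A joint construction (X', Y') enters the infimum only through its joint law.
   Values in ennreal: infinity is allowed when a first moment is infinite. *)
definition W1 :: "real measure \<Rightarrow> real measure \<Rightarrow> ennreal" where
  "W1 \<mu> \<nu> = (INF \<pi> \<in> couplings \<mu> \<nu>. \<integral>\<^sup>+ z. ennreal \<bar>fst z - snd z\<bar> \<partial>\<pi>)"

end

theory Submission
  imports Defs "HOL-Real_Asymp.Real_Asymp"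
begin

text \<open>
  Any coupling of two laws bounds the difference of the expectations of a Lipschitz function,
  whether or not these expectations exist: if the coupling cost is finite, the function is
  integrable under both laws or under neither. For the second inequality, the quantile coupling
  on the unit interval has cost equal to the \<open>L\<^sup>1\<close> distance of the distribution functions
  (by Tonelli applied to $|a-b| = \int |1_{a\le y}-1_{b\le y}|\,dy$), and the exponential bound
  on that distance is integrated over the positive half-line; on the negative half-line both
  distribution functions vanish.
\<close>

section \<open>Passage time and overshoot: sign and measurability\<close>

text \<open>A nonempty set of naturals contains its infimum, and the empty infimum in
  \<open>enat\<close> is \<open>\<infinity>\<close>. A least index in \<open>nat\<close> is the form
  from which measurability of the overshoot can be derived.\<close>

lemma passage_time_eq_Least:
  "passage_time X b \<omega> =
    (if \<exists>n. 1 \<le> n \<and> b < partial_sum X n \<omega>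
     then enat (LEAST n. 1 \<le> n \<and> b < partial_sum X n \<omega>) else \<infinity>)"
proof (cases "\<exists>n. 1 \<le> n \<and> b < partial_sum X n \<omega>")
  case True
  let ?P = "\<lambda>n. 1 \<le> n \<and> b < partial_sum X n \<omega>"
  have "passage_time X b \<omega> = enat (LEAST n. ?P n)"
    unfolding passage_time_def
  proof (rule antisym)
    show "(INF n\<in>{n. ?P n}. enat n) \<le> enat (LEAST n. ?P n)"
      using LeastI_ex[OF True] by (intro INF_lower) auto
    show "enat (LEAST n. ?P n) \<le> (INF n\<in>{n. ?P n}. enat n)"
      by (intro INF_greatest) (auto intro: Least_le)
  qed
  with True show ?thesis by simp
next
  case False
  then have "{n. 1 \<le> n \<and> b < partial_sum X n \<omega>} = {}" by auto
  with False show ?thesis by (simp only: passage_time_def) (simp add: top_enat_def)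
qed

lemma overshoot_eq_Least:
  "overshoot X b \<omega> =
    (if \<exists>n. 1 \<le> n \<and> b < partial_sum X n \<omega>
     then partial_sum X (LEAST n. 1 \<le> n \<and> b < partial_sum X n \<omega>) \<omega> - b else 0)"
  by (auto simp: overshoot_def passage_time_eq_Least)

lemma overshoot_nonneg: "0 \<le> overshoot X b \<omega>"
proof (cases "\<exists>n. 1 \<le> n \<and> b < partial_sum X n \<omega>")
  case True
  from LeastI_ex[OF this] True show ?thesis by (simp add: overshoot_eq_Least)
next
  case False
  then show ?thesis unfolding overshoot_eq_Least by (simp only: if_False order_refl)
qed

lemma overshoot_measurable:
  assumes X: "\<And>n. 1 \<le> n \<Longrightarrow> X n \<in> borel_measurable M"
  shows "overshoot X b \<in> borel_measurable M"
proof -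
  have [measurable]: "partial_sum X n \<in> borel_measurable M" for n
    unfolding partial_sum_def[abs_def] by (intro borel_measurable_sum X) auto
  \<comment> \<open>A random index with countably many values keeps the composition measurable.
    Where no index qualifies, \<open>LEAST\<close> is arbitrary, but the overshoot takes its other
    branch there.\<close>
  have [measurable]: "(\<lambda>\<omega>. partial_sum X (LEAST n. 1 \<le> n \<and> b < partial_sum X n \<omega>) \<omega>)
      \<in> borel_measurable M"
    by (rule measurable_compose_countable[where f = "partial_sum X"]) measurable
  show ?thesis
    unfolding overshoot_eq_Least[abs_def] by measurable
qed

lemma iid_with_law_overshoot_measurable:
  assumes "iid_with_law M X F"
  shows "overshoot X b \<in> borel_measurable M"
proof -
  interpret prob_space M using assms by (simp add: iid_with_law_def)
  show ?thesis
    using assms by (intro overshoot_measurable) (auto simp: iid_with_law_def indep_vars_def)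
qed

section \<open>Lipschitz functions under a coupling\<close>

text \<open>Under a coupling both integrals live on one space, where the integrand difference is at
  most L times the distance of the coordinates. If \<open>?B\<close> is infinite there is nothing to
  prove; otherwise \<open>?u\<close> is integrable.\<close>

lemma coupling_lipschitz_bound:
  fixes h :: "real \<Rightarrow> real"
  assumes \<pi>: "\<pi> \<in> couplings \<mu> \<nu>" and h: "L-lipschitz_on UNIV h"
  shows "ennreal \<bar>integral\<^sup>L \<mu> h - integral\<^sup>L \<nu> h\<bar> \<le> ennreal L * (\<integral>\<^sup>+z. ennreal \<bar>fst z - snd z\<bar> \<partial>\<pi>)"
    (is "_ \<le> ?B")
proof (cases "?B = \<infinity>")
  case False
  have sets[measurable_cong]: "sets \<pi> = sets (borel \<Otimes>\<^sub>M borel)"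
    and \<mu>: "\<mu> = distr \<pi> borel fst" and \<nu>: "\<nu> = distr \<pi> borel snd"
    using \<pi> by (auto simp: couplings_def)
  have [measurable]: "h \<in> borel_measurable borel"
    using lipschitz_on_continuous_on[OF h] by (rule borel_measurable_continuous_onI)
  let ?u = "\<lambda>z. h (fst z) - h (snd z)"
  have "(\<integral>\<^sup>+z. ennreal \<bar>?u z\<bar> \<partial>\<pi>) \<le> (\<integral>\<^sup>+z. ennreal L * ennreal \<bar>fst z - snd z\<bar> \<partial>\<pi>)"
    using lipschitz_on_normD[OF h] lipschitz_on_nonneg[OF h]
    by (intro nn_integral_mono) (auto simp: ennreal_mult[symmetric] intro!: ennreal_leI)
  also have "\<dots> = ?B"
    by (rule nn_integral_cmult) measurable
  finally have le: "(\<integral>\<^sup>+z. ennreal \<bar>?u z\<bar> \<partial>\<pi>) \<le> ?B" .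
  have u: "integrable \<pi> ?u"
    using le False by (intro integrableI_bounded) (auto simp: less_top top_unique)
  have "integral\<^sup>L \<mu> h - integral\<^sup>L \<nu> h = (\<integral>z. h (fst z) \<partial>\<pi>) - (\<integral>z. h (snd z) \<partial>\<pi>)"
    unfolding \<mu> \<nu> by (simp add: integral_distr)
  \<comment> \<open>The two functions differ by the integrable \<open>?u\<close>. If neither is
    integrable, both Bochner integrals are 0 by convention, so the left side is 0.\<close>
  also have "\<bar>\<dots>\<bar> \<le> \<bar>\<integral>z. ?u z \<partial>\<pi>\<bar>"
  proof (cases "integrable \<pi> (\<lambda>z. h (fst z))")
    case True
    from Bochner_Integration.integrable_diff[OF True u] have "integrable \<pi> (\<lambda>z. h (snd z))"
      by simp
    with True show ?thesis by simp
  next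
    case False
    have "\<not> integrable \<pi> (\<lambda>z. h (snd z))"
    proof
      assume "integrable \<pi> (\<lambda>z. h (snd z))"
      from Bochner_Integration.integrable_add[OF this u] False show False by simp
    qed
    with False show ?thesis by (simp add: not_integrable_integral_eq)
  qed
  finally have "ennreal \<bar>integral\<^sup>L \<mu> h - integral\<^sup>L \<nu> h\<bar> \<le> ennreal \<bar>\<integral>z. ?u z \<partial>\<pi>\<bar>"
    by (rule ennreal_leI)
  also have "\<dots> \<le> (\<integral>\<^sup>+z. ennreal \<bar>?u z\<bar> \<partial>\<pi>)"
    using integral_norm_bound_ennreal[OF u] by simp
  also note le
  finally show ?thesis .
qed simp

section \<open>The quantile coupling and its cost\<close>

text \<open>The two indicators differ exactly on the half-open interval between a and b. Closed
  half-lines are chosen so that membership reads a \<le> y, matching the convention for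
  \<open>cdf\<close>.\<close>

lemma nn_integral_abs_diff_indicator:
  fixes a b :: real
  shows "(\<integral>\<^sup>+y. ennreal \<bar>indicator {a..} y - indicator {b..} y\<bar> \<partial>lborel) = ennreal \<bar>a - b\<bar>"
proof -
  have "(\<integral>\<^sup>+y. ennreal \<bar>indicator {a..} y - indicator {b..} y\<bar> \<partial>lborel)
      = (\<integral>\<^sup>+y. indicator {min a b..<max a b} y \<partial>lborel)"
    by (intro nn_integral_cong) (auto simp: indicator_def)
  also have "\<dots> = ennreal \<bar>a - b\<bar>"
    by (simp add: min_def max_def)
  finally show ?thesis .
qed

lemma real_distribution_coupling_cdf:
  assumes "real_distribution \<mu>" "real_distribution \<nu>"
  obtains \<pi> where "\<pi> \<in> couplings \<mu> \<nu>"
    and "(\<integral>\<^sup>+z. ennreal \<bar>fst z - snd z\<bar> \<partial>\<pi>) = (\<integral>\<^sup>+y. ennreal \<bar>cdf \<mu> y - cdf \<nu> y\<bar> \<partial>lborel)"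
proof -
  interpret \<mu>: cdf_distribution \<mu> using assms by (simp add: cdf_distribution_def)
  interpret \<nu>: cdf_distribution \<nu> using assms by (simp add: cdf_distribution_def)
  \<comment> \<open>One uniform variable drives both quantile functions \<open>\<mu>.I\<close> and
    \<open>\<nu>.I\<close>. The endpoints are left out because quantiles there may be
    infinite.\<close>
  define \<Omega> where "\<Omega> = (restrict_space lborel {0<..<1} :: real measure)"
  interpret \<Omega>: prob_space \<Omega>
    by (auto simp: \<Omega>_def space_restrict_space emeasure_restrict_space intro!: prob_spaceI)
  have sets_\<Omega>: "sets \<Omega> = sets (restrict_space borel {0<..<1})"
    unfolding \<Omega>_def by (intro sets_restrict_space_cong) simp
  have [measurable]: "\<mu>.I \<in> borel_measurable \<Omega>" "\<nu>.I \<in> borel_measurable \<Omega>"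
    using \<mu>.measurable_CI \<nu>.measurable_CI
    by (simp_all add: measurable_cong_sets[OF sets_\<Omega> refl])
  have space_\<Omega>: "space \<Omega> = {0<..<1}"
    by (simp add: \<Omega>_def space_restrict_space)
  define \<pi> where "\<pi> = distr \<Omega> (borel \<Otimes>\<^sub>M borel) (\<lambda>\<omega>. (\<mu>.I \<omega>, \<nu>.I \<omega>))"
  have "prob_space \<pi>"
    unfolding \<pi>_def by (rule \<Omega>.prob_space_distr) measurable
  moreover have "distr \<pi> borel fst = \<mu>" "distr \<pi> borel snd = \<nu>"
    using \<mu>.distr_I_eq_M \<nu>.distr_I_eq_M
    by (simp_all add: \<pi>_def distr_distr comp_def \<Omega>_def[symmetric])
  ultimately have coupling: "\<pi> \<in> couplings \<mu> \<nu>"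
    by (simp add: couplings_def \<pi>_def)

  interpret pair_sigma_finite \<Omega> lborel
    by (intro pair_sigma_finite.intro \<Omega>.sigma_finite_measure_axioms sigma_finite_lborel)
  have *: "(\<integral>\<^sup>+\<omega>. ennreal \<bar>indicator {\<mu>.I \<omega>..} y - indicator {\<nu>.I \<omega>..} y\<bar> \<partial>\<Omega>)
      = ennreal \<bar>cdf \<mu> y - cdf \<nu> y\<bar>" for y
  proof -
    \<comment> \<open>On the open unit interval, I(\<omega>) \<le> y holds iff \<omega> is at most
      the cdf at y. So for fixed y the two events are initial segments in \<omega>, and they differ
      exactly on \<open>?J\<close>.\<close>
    let ?J = "{min (cdf \<mu> y) (cdf \<nu> y)<..max (cdf \<mu> y) (cdf \<nu> y)}"
    have bounds: "0 \<le> cdf \<mu> y" "cdf \<mu> y \<le> 1" "0 \<le> cdf \<nu> y" "cdf \<nu> y \<le> 1"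
      by (simp_all add: \<mu>.cdf_nonneg \<nu>.cdf_nonneg \<mu>.cdf_bounded_prob \<nu>.cdf_bounded_prob)
    have "(\<integral>\<^sup>+\<omega>. ennreal \<bar>indicator {\<mu>.I \<omega>..} y - indicator {\<nu>.I \<omega>..} y\<bar> \<partial>\<Omega>)
        = (\<integral>\<^sup>+\<omega>. indicator ?J \<omega> \<partial>\<Omega>)"
      by (intro nn_integral_cong)
        (auto simp: space_\<Omega> indicator_def \<mu>.pseudoinverse[symmetric] \<nu>.pseudoinverse[symmetric])
    also have "\<dots> = (\<integral>\<^sup>+\<omega>. indicator ?J \<omega> * indicator {0<..<1} \<omega> \<partial>lborel)"
      unfolding \<Omega>_def by (rule nn_integral_restrict_space) simp
    also have "\<dots> = (\<integral>\<^sup>+\<omega>. indicator ?J \<omega> \<partial>lborel)"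
      \<comment> \<open>\<open>?J\<close> lies in (0,1], so the restriction to (0,1) can remove only
        the null point 1.\<close>
      using bounds AE_lborel_singleton[of "1::real"]
      by (intro nn_integral_cong_AE) (auto simp: indicator_def)
    also have "\<dots> = ennreal \<bar>cdf \<mu> y - cdf \<nu> y\<bar>"
      by (simp add: min_def max_def)
    finally show ?thesis .
  qed
  have "(\<integral>\<^sup>+z. ennreal \<bar>fst z - snd z\<bar> \<partial>\<pi>) = (\<integral>\<^sup>+\<omega>. ennreal \<bar>\<mu>.I \<omega> - \<nu>.I \<omega>\<bar> \<partial>\<Omega>)"
    unfolding \<pi>_def by (subst nn_integral_distr) simp_all
  also have "\<dots> = (\<integral>\<^sup>+\<omega>. \<integral>\<^sup>+y. ennreal \<bar>indicator {\<mu>.I \<omega>..} y - indicator {\<nu>.I \<omega>..} y\<bar> \<partial>lborel \<partial>\<Omega>)"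
    by (simp only: nn_integral_abs_diff_indicator)
  also have "\<dots> = (\<integral>\<^sup>+y. \<integral>\<^sup>+\<omega>. ennreal \<bar>indicator {\<mu>.I \<omega>..} y - indicator {\<nu>.I \<omega>..} y\<bar> \<partial>\<Omega> \<partial>lborel)"
    \<comment> \<open>Tonelli needs joint measurability in (\<omega>, y), which is visible once the
      indicators are written as comparisons of I(\<omega>) with y.\<close>
    unfolding indicator_def atLeast_iff by (rule Fubini'[symmetric]) measurable
  also have "\<dots> = (\<integral>\<^sup>+y. ennreal \<bar>cdf \<mu> y - cdf \<nu> y\<bar> \<partial>lborel)"
    by (simp only: *)
  finally show ?thesis
    using that coupling by blast
qed

section \<open>Bounds on either side of the Wasserstein distance\<close>

lemma W1_le_nn_integral_cdf:
  assumes "real_distribution \<mu>" "real_distribution \<nu>"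
  shows "W1 \<mu> \<nu> \<le> (\<integral>\<^sup>+y. ennreal \<bar>cdf \<mu> y - cdf \<nu> y\<bar> \<partial>lborel)"
proof (rule real_distribution_coupling_cdf[OF assms])
  fix \<pi> assume \<pi>: "\<pi> \<in> couplings \<mu> \<nu>"
    and cost: "(\<integral>\<^sup>+z. ennreal \<bar>fst z - snd z\<bar> \<partial>\<pi>) = (\<integral>\<^sup>+y. ennreal \<bar>cdf \<mu> y - cdf \<nu> y\<bar> \<partial>lborel)"
  show ?thesis
    unfolding W1_def cost[symmetric] using \<pi> by (rule INF_lower)
qed

text \<open>For positive L, dividing by L turns the left side into a lower bound for every coupling
  cost, hence for their infimum.\<close>

lemma W1_lipschitz_bound:
  fixes h :: "real \<Rightarrow> real"
  assumes "real_distribution \<mu>" "real_distribution \<nu>" and h: "L-lipschitz_on UNIV h"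
  shows "ennreal \<bar>integral\<^sup>L \<mu> h - integral\<^sup>L \<nu> h\<bar> \<le> ennreal L * W1 \<mu> \<nu>"
proof -
  let ?d = "ennreal \<bar>integral\<^sup>L \<mu> h - integral\<^sup>L \<nu> h\<bar>"
  have bound: "?d \<le> ennreal L * (\<integral>\<^sup>+z. ennreal \<bar>fst z - snd z\<bar> \<partial>\<pi>)" if "\<pi> \<in> couplings \<mu> \<nu>" for \<pi>
    using that h by (rule coupling_lipschitz_bound)
  show ?thesis
  proof (cases "L = 0")
    case True
    \<comment> \<open>The right side is 0 here, so the difference must vanish. This follows from any
      single coupling, and the quantile coupling supplies one.\<close>
    obtain \<pi> where "\<pi> \<in> couplings \<mu> \<nu>"
      using real_distribution_coupling_cdf[OF assms(1,2)] by blast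
    from bound[OF this] True show ?thesis by simp
  next
    case False
    then have L: "0 < L" using lipschitz_on_nonneg[OF h] by simp
    then have "?d / ennreal L \<le> W1 \<mu> \<nu>"
      unfolding W1_def using bound by (intro INF_greatest divide_le_posI_ennreal) auto
    then have "ennreal L * (?d / ennreal L) \<le> ennreal L * W1 \<mu> \<nu>"
      by (intro mult_left_mono) auto
    then show ?thesis
      using L by (simp add: divide_ennreal ennreal_mult[symmetric])
  qed
qed

lemma real_distribution_cdf_neg_eq_0:
  assumes "real_distribution \<mu>" "AE x in \<mu>. 0 \<le> x" "y < 0"
  shows "cdf \<mu> y = 0"
proof -
  interpret real_distribution \<mu> by fact
  have "AE x in \<mu>. x \<notin> {..y}" using assms(2) by eventually_elim (use assms(3) in auto)
  then show ?thesis unfolding cdf_def by (subst prob_eq_0) auto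
qed

text \<open>Applied below with A = C exp(-r b), which keeps the decay in b apart from the
  integration in y.\<close>

lemma W1_le_exponential:
  assumes \<mu>: "real_distribution \<mu>" "AE x in \<mu>. 0 \<le> x"
    and \<nu>: "real_distribution \<nu>" "AE x in \<nu>. 0 \<le> x"
    and r: "r > 0" and A: "A \<ge> 0"
    and bound: "\<And>y. y > 0 \<Longrightarrow> \<bar>cdf \<mu> y - cdf \<nu> y\<bar> \<le> A * exp (- r * y)"
  shows "W1 \<mu> \<nu> \<le> ennreal (A / r)"
proof -
  have "W1 \<mu> \<nu> \<le> (\<integral>\<^sup>+y. ennreal \<bar>cdf \<mu> y - cdf \<nu> y\<bar> \<partial>lborel)"
    by (rule W1_le_nn_integral_cdf) fact+
  also have "\<dots> \<le> (\<integral>\<^sup>+y. ennreal (A * exp (- r * y)) * indicator {0..} y \<partial>lborel)"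
  proof (rule nn_integral_mono_AE)
    show "AE y in lborel. ennreal \<bar>cdf \<mu> y - cdf \<nu> y\<bar> \<le> ennreal (A * exp (- r * y)) * indicator {0..} y"
      \<comment> \<open>The bound is available only for y > 0 and both cdfs vanish for y < 0; the
        remaining point is null.\<close>
      using AE_lborel_singleton[of "0::real"]
    proof eventually_elim
      case (elim y)
      show ?case
      proof (cases "y < 0")
        case True
        then show ?thesis
          using real_distribution_cdf_neg_eq_0[OF \<mu> True] real_distribution_cdf_neg_eq_0[OF \<nu> True]
          by simp
      next
        case False
        with elim have "y > 0" by simp
        from bound[OF this] this show ?thesis by (simp add: ennreal_leI)
      qed
    qed
  qed
  \<comment> \<open>Limit at infinity minus value at 0 of the antiderivative -(A/r) exp(-r
    y).\<close>
  also have "\<dots> = ennreal (0 - (- (A / r) * exp (- r * 0)))"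
  proof (rule nn_integral_FTC_atLeast)
    show "((\<lambda>y. - (A / r) * exp (- r * y)) has_real_derivative A * exp (- r * y)) (at y)" for y
      using r by (auto intro!: derivative_eq_intros)
    show "((\<lambda>y. - (A / r) * exp (- r * y)) \<longlongrightarrow> 0) at_top"
      using r by real_asymp
  qed (use A in auto)
  finally show ?thesis by simp
qed

section \<open>Uniform bounds for the overshoot laws\<close>

text \<open>The suprema in the conclusion are taken in \<open>ennreal\<close>, where they always
  exist. The one in \<open>uniform\<close> is real, so extracting a single parameter from it
  requires boundedness.\<close>

theorem corollary4:
  fixes F0 :: "real measure" and \<theta>max :: ereal
    and P :: "real \<Rightarrow> 'w measure" and X :: "nat \<Rightarrow> 'w \<Rightarrow> real"
    and \<rho> :: "real \<Rightarrow> real measure"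
    and C r \<theta>s :: real
  assumes family: "standard_exp_family F0 \<theta>max"
    and iid: "\<And>\<theta>. \<theta> \<in> param_set \<theta>max \<Longrightarrow> iid_with_law (P \<theta>) X (tilted F0 \<theta>)"
    and limit_law: "\<And>\<theta>. \<theta> \<in> param_set \<theta>max \<Longrightarrow> is_limit_overshoot_law (P \<theta>) X (\<rho> \<theta>)"
    and constants: "C > 0" "r > 0" "\<theta>s > 0" "{0..\<theta>s} \<subseteq> param_set \<theta>max"
    and uniform: "\<And>b y. b > 0 \<Longrightarrow> y > 0 \<Longrightarrow>
      (SUP \<theta>\<in>{0..\<theta>s}. \<bar>measure (P \<theta>) {\<omega> \<in> space (P \<theta>). overshoot X b \<omega> \<le> y}
                      - measure (\<rho> \<theta>) {..y}\<bar>) \<le> C * exp (- r * (b + y))"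
  shows "\<forall>(g :: real \<Rightarrow> real) Lip b. Lip-lipschitz_on {0..} g \<longrightarrow> b > 0 \<longrightarrow>
      (SUP \<theta>\<in>{0..\<theta>s}. ennreal \<bar>(\<integral>\<omega>. g (overshoot X b \<omega>) \<partial>P \<theta>) - (LINT x:{0..}|\<rho> \<theta>. g x)\<bar>)
        \<le> ennreal Lip * (SUP \<theta>\<in>{0..\<theta>s}. W1 (overshoot_law (P \<theta>) X b) (\<rho> \<theta>))
    \<and> ennreal Lip * (SUP \<theta>\<in>{0..\<theta>s}. W1 (overshoot_law (P \<theta>) X b) (\<rho> \<theta>))
        \<le> ennreal (Lip * (C / r) * exp (- r * b))"
proof (intro allI impI conjI)
  fix g :: "real \<Rightarrow> real" and Lip b :: real
  assume g: "Lip-lipschitz_on {0..} g" and b: "b > 0"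
  note Lip = lipschitz_on_nonneg[OF g]
  have in_set: "\<theta> \<in> param_set \<theta>max" if "\<theta> \<in> {0..\<theta>s}" for \<theta>
    using that constants(4) by auto
  have prob: "prob_space (P \<theta>)" and R[measurable]: "overshoot X b \<in> borel_measurable (P \<theta>)"
    if "\<theta> \<in> {0..\<theta>s}" for \<theta> b
    using iid[OF in_set[OF that]] iid_with_law_overshoot_measurable
    by (auto simp: iid_with_law_def)
  have rd: "real_distribution (overshoot_law (P \<theta>) X b)" if "\<theta> \<in> {0..\<theta>s}" for \<theta>
    using prob_space.prob_space_distr[OF prob R] that
    by (simp add: real_distribution_def real_distribution_axioms_def)
  have nonneg: "AE x in overshoot_law (P \<theta>) X b. 0 \<le> x" if "\<theta> \<in> {0..\<theta>s}" for \<theta>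
    using R[OF that] by (simp add: AE_distr_iff overshoot_nonneg)
  have \<rho>: "real_distribution (\<rho> \<theta>)" "AE x in \<rho> \<theta>. 0 \<le> x" if "\<theta> \<in> {0..\<theta>s}" for \<theta>
    using limit_law[OF in_set[OF that]] by (auto simp: is_limit_overshoot_law_def)
  have cdf_R: "cdf (overshoot_law (P \<theta>) X b) y
      = measure (P \<theta>) {\<omega> \<in> space (P \<theta>). overshoot X b \<omega> \<le> y}" if "\<theta> \<in> {0..\<theta>s}" for \<theta> y
    using R[OF that] by (auto simp: cdf_def measure_distr intro!: arg_cong2[where f = measure])

  have W1_bound: "W1 (overshoot_law (P \<theta>) X b) (\<rho> \<theta>) \<le> ennreal (C * exp (- r * b) / r)"
    if \<theta>: "\<theta> \<in> {0..\<theta>s}" for \<theta>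
  proof (rule W1_le_exponential[OF rd[OF \<theta>] nonneg[OF \<theta>] \<rho>[OF \<theta>] constants(2)])
    fix y :: real assume y: "y > 0"
    let ?D = "\<lambda>\<theta>. \<bar>measure (P \<theta>) {\<omega> \<in> space (P \<theta>). overshoot X b \<omega> \<le> y} - measure (\<rho> \<theta>) {..y}\<bar>"
    \<comment> \<open>A difference of two probabilities is at most 1, so the real supremum dominates
      each of its members.\<close>
    have "?D t \<le> 1" if t: "t \<in> {0..\<theta>s}" for t
    proof -
      interpret P: prob_space "P t" using prob[OF t] .
      interpret \<rho>: real_distribution "\<rho> t" using \<rho>(1)[OF t] .
      show ?thesis
        by (intro abs_leI) (smt (verit) P.prob_le_1 \<rho>.prob_le_1 measure_nonneg)+
    qed
    then have "bdd_above (?D ` {0..\<theta>s})"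
      by (intro bdd_aboveI2)
    then have "?D \<theta> \<le> (SUP \<theta>\<in>{0..\<theta>s}. ?D \<theta>)"
      using \<theta> by (rule cSUP_upper[rotated])
    also have "\<dots> \<le> C * exp (- r * (b + y))"
      by (rule uniform[OF b y])
    also have "\<dots> = C * exp (- r * b) * exp (- r * y)"
      by (simp add: exp_add[symmetric] algebra_simps)
    finally show "\<bar>cdf (overshoot_law (P \<theta>) X b) y - cdf (\<rho> \<theta>) y\<bar> \<le> C * exp (- r * b) * exp (- r * y)"
      unfolding cdf_R[OF \<theta>] by (simp add: cdf_def)
  qed (use constants in simp)
  have "ennreal Lip * (SUP \<theta>\<in>{0..\<theta>s}. W1 (overshoot_law (P \<theta>) X b) (\<rho> \<theta>))
      \<le> ennreal Lip * ennreal (C * exp (- r * b) / r)"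
    by (intro mult_left_mono SUP_least W1_bound) auto
  also have "\<dots> = ennreal (Lip * (C / r) * exp (- r * b))"
    using Lip constants by (simp add: ennreal_mult[symmetric])
  finally show "ennreal Lip * (SUP \<theta>\<in>{0..\<theta>s}. W1 (overshoot_law (P \<theta>) X b) (\<rho> \<theta>))
      \<le> ennreal (Lip * (C / r) * exp (- r * b))" .

  \<comment> \<open>Outside the half-line \<open>g\<close> need not even be measurable, so it is extended by \<open>g 0\<close>.\<close>
  define h where "h x = g (max 0 x)" for x
  have h: "Lip-lipschitz_on UNIV h"
  proof (rule lipschitz_onI)
    fix x y :: real
    have "dist (h x) (h y) \<le> Lip * dist (max 0 x) (max 0 y)"
      unfolding h_def by (rule lipschitz_onD[OF g]) auto
    \<comment> \<open>Clipping at 0 is a contraction, so the extension keeps the constant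
      \<open>Lip\<close>.\<close>
    also have "\<dots> \<le> Lip * dist x y"
      by (intro mult_left_mono Lip) (auto simp: dist_real_def max_def)
    finally show "dist (h x) (h y) \<le> Lip * dist x y" .
  qed (rule Lip)
  have h_meas: "h \<in> borel_measurable borel"
    using lipschitz_on_continuous_on[OF h] by (rule borel_measurable_continuous_onI)
  show "(SUP \<theta>\<in>{0..\<theta>s}. ennreal \<bar>(\<integral>\<omega>. g (overshoot X b \<omega>) \<partial>P \<theta>) - (LINT x:{0..}|\<rho> \<theta>. g x)\<bar>)
      \<le> ennreal Lip * (SUP \<theta>\<in>{0..\<theta>s}. W1 (overshoot_law (P \<theta>) X b) (\<rho> \<theta>))"
  proof (rule SUP_least)
    fix \<theta> assume \<theta>: "\<theta> \<in> {0..\<theta>s}"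
    interpret \<rho>: real_distribution "\<rho> \<theta>" using \<rho>(1)[OF \<theta>] .
    have "(\<integral>\<omega>. g (overshoot X b \<omega>) \<partial>P \<theta>) = integral\<^sup>L (overshoot_law (P \<theta>) X b) h"
      \<comment> \<open>The overshoot is nonnegative everywhere, so g and h agree along it
        pointwise.\<close>
      using R[OF \<theta>] h_meas by (simp add: integral_distr h_def overshoot_nonneg max_absorb2)
    moreover have "(LINT x:{0..}|\<rho> \<theta>. g x) = integral\<^sup>L (\<rho> \<theta>) h"
    proof -
      \<comment> \<open>First g is replaced by the measurable h on the half-line, where they
        coincide. Only then is the half-line dropped by an almost-everywhere argument, which needs
        measurability.\<close>
      have "(LINT x:{0..}|\<rho> \<theta>. g x) = (LINT x:{0..}|\<rho> \<theta>. h x)"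
        unfolding set_lebesgue_integral_def
        by (intro Bochner_Integration.integral_cong) (auto simp: h_def indicator_def)
      also have "\<dots> = integral\<^sup>L (\<rho> \<theta>) h"
        unfolding set_lebesgue_integral_def
        using \<rho>(2)[OF \<theta>] h_meas by (intro integral_cong_AE) (auto simp: indicator_def)
      finally show ?thesis .
    qed
    ultimately have "ennreal \<bar>(\<integral>\<omega>. g (overshoot X b \<omega>) \<partial>P \<theta>) - (LINT x:{0..}|\<rho> \<theta>. g x)\<bar>
        \<le> ennreal Lip * W1 (overshoot_law (P \<theta>) X b) (\<rho> \<theta>)"
      using W1_lipschitz_bound[OF rd[OF \<theta>] \<rho>(1)[OF \<theta>] h] by simp
    also have "\<dots> \<le> ennreal Lip * (SUP \<theta>\<in>{0..\<theta>s}. W1 (overshoot_law (P \<theta>) X b) (\<rho> \<theta>))"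
      using \<theta> by (intro mult_left_mono SUP_upper) auto
    finally show "ennreal \<bar>(\<integral>\<omega>. g (overshoot X b \<omega>) \<partial>P \<theta>) - (LINT x:{0..}|\<rho> \<theta>. g x)\<bar>
        \<le> ennreal Lip * (SUP \<theta>\<in>{0..\<theta>s}. W1 (overshoot_law (P \<theta>) X b) (\<rho> \<theta>))" .
  qed
qed

end
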